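(* Let $F=(F_1,F_2,\ldots,F_m):\mathbb{R}^m\to\mathbb{R}^m$ be a mapping with components $F_i:\mathbb{R}^m\to\mathbb{R}$, $i\in\{1,\ldots,m\}$, and let $x\in\mathbb{R}^m$ be a point at which $F$ is differentiable. If $$\left|\nabla_{x_i}F_i(x)\right|>\sum_{\substack{j=1\\ j\neq i}}^m\left|\nabla_{x_j}F_i(x)\right|\qquad\text{for every } i\in\{1,\ldots,m\},$$ then $|\nabla F(x)|\neq 0$.
   Context: $\nabla_{x_j}F_i(x)$ denotes the partial derivative of $F_i$ with respect to the variable $x_j$ at $x$. $\nabla F(x)$ denotes the Jacobian matrix of $F$ at $x$ (with $(i,j)$ entry $\nabla_{x_j}F_i(x)$), and $|\nabla F(x)|$ denotes its determinant. *)

theory Defs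
  imports "HOL-Analysis.Analysis"
begin

definition partial_derivative :: "'n::finite \<Rightarrow> (real ^ 'n \<Rightarrow> real) \<Rightarrow> real ^ 'n \<Rightarrow> real" where
  "partial_derivative j f x = deriv (\<lambda>t. f (x + t *\<^sub>R axis j 1)) 0"

lemma partial_derivative_eq:
  fixes F :: "real ^ 'n::finite \<Rightarrow> real ^ 'm::finite"
  assumes "(F has_derivative F') (at x)"
  shows "partial_derivative j (\<lambda>y. F y $ i) x = F' (axis j 1) $ i"
proof -
  have line: "((\<lambda>t. x + t *\<^sub>R axis j 1) has_derivative (\<lambda>t. t *\<^sub>R axis j 1)) (at (0::real))"
    by (auto intro!: derivative_eq_intros)
  have "((\<lambda>t. F (x + t *\<^sub>R axis j 1)) has_derivative (\<lambda>t. F' (t *\<^sub>R axis j 1))) (at (0::real))"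
    using has_derivative_compose[OF line, of F F'] assms by simp
  then have "((\<lambda>t. F (x + t *\<^sub>R axis j 1) $ i) has_derivative (\<lambda>t. F' (t *\<^sub>R axis j 1) $ i)) (at (0::real))"
    by (rule bounded_linear.has_derivative[OF bounded_linear_vec_nth])
  moreover have "(\<lambda>t. F' (t *\<^sub>R axis j 1) $ i) = (*) (F' (axis j 1) $ i)"
    using assms by (auto simp: fun_eq_iff linear_cmul has_derivative_linear)
  ultimately show ?thesis
    unfolding partial_derivative_def
    by (intro DERIV_imp_deriv) (simp add: has_field_derivative_def)
qed

lemma jacobian_entry:
  fixes F :: "real ^ 'n::finite \<Rightarrow> real ^ 'm::finite"
  assumes "F differentiable (at x)"
  shows "jacobian F (at x) $ i $ j = partial_derivative j (\<lambda>y. F y $ i) x"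
  using partial_derivative_eq[OF iffD1[OF frechet_derivative_works assms]]
  by (simp add: jacobian_def matrix_def)

end

theory Submission
  imports Defs
begin

text \<open>Differentiability makes the Jacobian entries the partial derivatives
  (\<open>jacobian_entry\<close>), so the claim is the Levy-Desplanques theorem. If A v = 0 with v
  nonzero, pick i with |v_i| maximal; row i gives |a_ii| |v_i| <= sum over j != i of |a_ij| |v_j| <=
  |v_i| times the off-diagonal row sum < |a_ii| |v_i|, a contradiction.\<close>

text \<open>At an index where a kernel vector of a strictly diagonally dominant matrix attains its
  largest absolute value, the corresponding row cannot vanish on it.\<close>

lemma strictly_diagonally_dominant_det_nonzero:
  fixes A :: "real ^ 'n::finite ^ 'n"
  assumes dom: "\<And>i. (\<Sum>j\<in>UNIV - {i}. \<bar>A $ i $ j\<bar>) < \<bar>A $ i $ i\<bar>"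
  shows "det A \<noteq> 0"
proof -
  have "v = 0" if ker: "A *v v = 0" for v
  proof (rule ccontr)
    assume "v \<noteq> 0"
    obtain i where max: "\<And>j. \<bar>v $ j\<bar> \<le> \<bar>v $ i\<bar>"
    proof -
      have "Max (range (\<lambda>j. \<bar>v $ j\<bar>)) \<in> range (\<lambda>j. \<bar>v $ j\<bar>)"
        by (intro Max_in) auto
      then obtain i where "Max (range (\<lambda>j. \<bar>v $ j\<bar>)) = \<bar>v $ i\<bar>"
        by (rule rangeE)
      moreover have "\<bar>v $ j\<bar> \<le> Max (range (\<lambda>j. \<bar>v $ j\<bar>))" for j
        by (intro Max_ge) auto
      ultimately show thesis
        using that[of i] by presburger
    qed
    obtain k where "v $ k \<noteq> 0"
      using \<open>v \<noteq> 0\<close> by (auto simp: vec_eq_iff)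
    \<comment> \<open>Positivity keeps the dominance inequality strict when it is multiplied by
      |v_i|.\<close>
    with max[of k] have pos: "\<bar>v $ i\<bar> > 0"
      by linarith
    have "(\<Sum>j\<in>UNIV. A $ i $ j * v $ j) = 0"
      using ker by (simp add: vec_eq_iff matrix_vector_mult_def)
    then have "A $ i $ i * v $ i = - (\<Sum>j\<in>UNIV - {i}. A $ i $ j * v $ j)"
      by (simp add: sum.remove[of UNIV i])
    then have "\<bar>A $ i $ i\<bar> * \<bar>v $ i\<bar> = \<bar>\<Sum>j\<in>UNIV - {i}. A $ i $ j * v $ j\<bar>"
      by (metis abs_minus_cancel abs_mult)
    also have "\<dots> \<le> (\<Sum>j\<in>UNIV - {i}. \<bar>A $ i $ j\<bar> * \<bar>v $ i\<bar>)"
      by (rule order.trans[OF sum_abs]) (auto simp: abs_mult intro!: sum_mono mult_left_mono max)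
    also have "\<dots> < \<bar>A $ i $ i\<bar> * \<bar>v $ i\<bar>"
      using dom[of i] pos by (simp flip: sum_distrib_right)
    finally show False by simp
  qed
  then show ?thesis
    \<comment> \<open>A trivial kernel yields a left inverse, which for a square matrix means
      invertibility.\<close>
    by (metis invertible_det_nz invertible_left_inverse matrix_left_invertible_ker)
qed

theorem lemma2:
  fixes F :: "real ^ 'm::finite \<Rightarrow> real ^ 'm" and x :: "real ^ 'm"
  assumes "F differentiable (at x)"
    and "\<And>i. \<bar>partial_derivative i (\<lambda>y. F y $ i) x\<bar>
             > (\<Sum>j\<in>UNIV - {i}. \<bar>partial_derivative j (\<lambda>y. F y $ i) x\<bar>)"
  shows "det (jacobian F (at x)) \<noteq> 0"
  using assms by (intro strictly_diagonally_dominant_det_nonzero) (simp add: jacobian_entry)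

end
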